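(* Let $G$ be a graph with $\mathrm{mz}(G)\leq 3$. Then $G$ does not contain any of the $25$ graphs $P_5,G_2,G_3,\dots,G_{25}$ listed in the context as an induced subgraph.
   Context: All graphs are finite and simple. Zero forcing: each vertex of a graph $G$ is blue or white. Color change rule: if $x$ is a blue vertex and $y$ is the only white neighbor of $x$, then $y$ turns blue. A set $B\subseteq V(G)$ is a zero forcing set if, starting with exactly the vertices of $B$ blue, all vertices of $G$ can be made blue by repeated applications of the rule. The zero forcing number $Z(G)$ is the minimum cardinality of a zero forcing set of $G$, and $\mathrm{mz}(G)=|V(G)|-Z(G)$. The $25$ graphs are as follows, where $ij$ denotes the edge $\{i,j\}$. $P_5$ on vertices $0,\dots,4$: $02,04,13,14$. On vertices $0,\dots,5$: $G_2$: $04,14,25,35,45$. $G_3$: $04,05,14,15,25,35$. $G_4$: $04,05,14,25,35,45$. $G_5$: $04,05,14,15,25,35,45$. $G_6$: $04,05,14,15,24,35,45$. $G_7$: $03,05,14,15,25,35$. $G_8$: $03,04,05,14,15,25$. $G_9$: $03,04,05,14,25,45$. $G_{10}$: $03,04,05,14,15,25,35$. $G_{11}$: $03,04,05,14,15,25,45$. $G_{12}$: $03,04,05,14,15,25,35,45$. $G_{13}$: $03,05,14,15,24,25,45$. $G_{14}$: $03,04,05,14,15,24,35,45$. $G_{15}$: $02,04,05,13,14,15,24,35$. $G_{16}$: $02,04,05,13,14,15,24,35,45$. On vertices $0,\dots,6$: $G_{17}$: $04,06,15,16,26,36,46,56$. $G_{18}$: $04,05,06,15,16,25,26,36,45,46$.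 $G_{19}$: $04,05,06,15,16,25,26,36,45,46,56$. On vertices $0,\dots,5$: $G_{20}$: $04,14,25,35$. $G_{21}$: $03,05,14,25$. On vertices $0,\dots,6$: $G_{22}$: $04,15,26,36$. $G_{23}$: $04,06,15,26,36,46$. $G_{24}$: $04,15,16,25,26,36,56$. On vertices $0,\dots,7$: $G_{25}$: $04,15,26,37$. *)

theory Defs
  imports "Graph_Theory.Graph_Theory"
begin

text \<open>
  Finite simple graphs are those of the locale \<^locale>\<open>graph\<close>: finite symmetric digraphs without
  loops and without parallel arcs. An undirected edge is a pair of opposite arcs, and
  \<open>u \<rightarrow>\<^bsub>G\<^esub> v\<close> is adjacency.
\<close>

inductive color_change :: "('a, 'b) pre_digraph \<Rightarrow> 'a set \<Rightarrow> 'a set \<Rightarrow> bool"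
  for G :: "('a, 'b) pre_digraph" where
  force: "x \<in> B \<Longrightarrow> {w \<in> verts G. x \<rightarrow>\<^bsub>G\<^esub> w \<and> w \<notin> B} = {y} \<Longrightarrow> color_change G B (insert y B)"

definition zero_forcing_set :: "('a, 'b) pre_digraph \<Rightarrow> 'a set \<Rightarrow> bool" where
  "zero_forcing_set G B \<longleftrightarrow> B \<subseteq> verts G \<and> (color_change G)\<^sup>*\<^sup>* B (verts G)"

definition zero_forcing_number :: "('a, 'b) pre_digraph \<Rightarrow> nat" where
  "zero_forcing_number G = (LEAST k. \<exists>B. zero_forcing_set G B \<and> card B = k)"

text \<open>The subtraction never truncates, see \<open>zero_forcing_number_le\<close> below.\<close>

definition mz :: "('a, 'b) pre_digraph \<Rightarrow> nat" where
  "mz G = card (verts G) - zero_forcing_number G"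

lemma zero_forcing_number_le: "zero_forcing_number G \<le> card (verts G)"
  unfolding zero_forcing_number_def
  by (rule Least_le) (auto simp: zero_forcing_set_def)

definition contains_induced :: "('a, 'b) pre_digraph \<Rightarrow> ('c, 'd) pre_digraph \<Rightarrow> bool" where
  "contains_induced G H \<longleftrightarrow> (\<exists>S. induced_subgraph S G \<and> digraph_iso S H)"

text \<open>
  The graph on the vertices \<open>0, \<dots>, n - 1\<close> with the listed edges, each listed once as
  \<open>(i, j)\<close> with \<open>i < j\<close>.
\<close>

definition edge_graph :: "nat \<Rightarrow> (nat \<times> nat) list \<Rightarrow> (nat, nat \<times> nat) pre_digraph" where
  "edge_graph n es = with_proj \<lparr> pverts = {..<n}, parcs = set es \<union> (set es)\<inverse> \<rparr>"

lemma edge_graph_simps: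
  "verts (edge_graph n es) = {..<n}"
  "u \<rightarrow>\<^bsub>edge_graph n es\<^esub> v \<longleftrightarrow> (u, v) \<in> set es \<or> (v, u) \<in> set es"
  by (auto simp: edge_graph_def)

text \<open>The graphs $P_5, G_2, G_3, \dots, G_{25}$, in this order.\<close>

definition forbidden_graphs :: "(nat, nat \<times> nat) pre_digraph list" where
  "forbidden_graphs = [
    edge_graph 5 [(0, 2), (0, 4), (1, 3), (1, 4)],
    edge_graph 6 [(0, 4), (1, 4), (2, 5), (3, 5), (4, 5)],
    edge_graph 6 [(0, 4), (0, 5), (1, 4), (1, 5), (2, 5), (3, 5)],
    edge_graph 6 [(0, 4), (0, 5), (1, 4), (2, 5), (3, 5), (4, 5)],
    edge_graph 6 [(0, 4), (0, 5), (1, 4), (1, 5), (2, 5), (3, 5), (4, 5)],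
    edge_graph 6 [(0, 4), (0, 5), (1, 4), (1, 5), (2, 4), (3, 5), (4, 5)],
    edge_graph 6 [(0, 3), (0, 5), (1, 4), (1, 5), (2, 5), (3, 5)],
    edge_graph 6 [(0, 3), (0, 4), (0, 5), (1, 4), (1, 5), (2, 5)],
    edge_graph 6 [(0, 3), (0, 4), (0, 5), (1, 4), (2, 5), (4, 5)],
    edge_graph 6 [(0, 3), (0, 4), (0, 5), (1, 4), (1, 5), (2, 5), (3, 5)],
    edge_graph 6 [(0, 3), (0, 4), (0, 5), (1, 4), (1, 5), (2, 5), (4, 5)],
    edge_graph 6 [(0, 3), (0, 4), (0, 5), (1, 4), (1, 5), (2, 5), (3, 5), (4, 5)],
    edge_graph 6 [(0, 3), (0, 5), (1, 4), (1, 5), (2, 4), (2, 5), (4, 5)],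
    edge_graph 6 [(0, 3), (0, 4), (0, 5), (1, 4), (1, 5), (2, 4), (3, 5), (4, 5)],
    edge_graph 6 [(0, 2), (0, 4), (0, 5), (1, 3), (1, 4), (1, 5), (2, 4), (3, 5)],
    edge_graph 6 [(0, 2), (0, 4), (0, 5), (1, 3), (1, 4), (1, 5), (2, 4), (3, 5), (4, 5)],
    edge_graph 7 [(0, 4), (0, 6), (1, 5), (1, 6), (2, 6), (3, 6), (4, 6), (5, 6)],
    edge_graph 7 [(0, 4), (0, 5), (0, 6), (1, 5), (1, 6), (2, 5), (2, 6), (3, 6), (4, 5), (4, 6)],
    edge_graph 7 [(0, 4), (0, 5), (0, 6), (1, 5), (1, 6), (2, 5), (2, 6), (3, 6), (4, 5), (4, 6), (5, 6)],
    edge_graph 6 [(0, 4), (1, 4), (2, 5), (3, 5)],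
    edge_graph 6 [(0, 3), (0, 5), (1, 4), (2, 5)],
    edge_graph 7 [(0, 4), (1, 5), (2, 6), (3, 6)],
    edge_graph 7 [(0, 4), (0, 6), (1, 5), (2, 6), (3, 6), (4, 6)],
    edge_graph 7 [(0, 4), (1, 5), (1, 6), (2, 5), (2, 6), (3, 6), (5, 6)],
    edge_graph 8 [(0, 4), (1, 5), (2, 6), (3, 7)]
  ]"

lemma graph_edge_graph:
  assumes "list_all (\<lambda>(i, j). i < j \<and> j < n) es"
  shows "graph (edge_graph n es)"
proof -
  let ?P = "\<lparr> pverts = {..<n}, parcs = set es \<union> (set es)\<inverse> \<rparr>"
  have es: "i < j \<and> j < n" if "(i, j) \<in> set es" for i j
    using assms that by (auto simp: list_all_iff)
  interpret pair_graph ?P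
    by unfold_locales (auto simp: symmetric_def intro!: symI dest!: es)
  show ?thesis
    unfolding edge_graph_def by (rule pair_graphD_graph)
qed

lemma forbidden_graphs_are_graphs: "\<forall>H \<in> set forbidden_graphs. graph H"
  by (simp add: forbidden_graphs_def graph_edge_graph)

end

theory Submission
  imports Defs
begin

text \<open>
  The parameter \<open>mz\<close> does not decrease when passing from an induced subgraph to the whole graph:
  colour all the additional vertices blue. More concretely, \<open>mz G \<ge> k\<close> holds as soon as \<open>G\<close> has a
  forcing sequence \<open>(x\<^sub>1, y\<^sub>1), \<dots>, (x\<^sub>k, y\<^sub>k)\<close>, in which \<open>x\<^sub>i\<close> forces \<open>y\<^sub>i\<close> when exactly
  \<open>y\<^sub>i, \<dots>, y\<^sub>k\<close> are white, and such a sequence involves only adjacencies between its own members.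
  Each of the 25 graphs has a forcing sequence of length 4.
\<close>

definition forcing_sequence :: "('a, 'b) pre_digraph \<Rightarrow> ('a \<times> 'a) list \<Rightarrow> bool" where
  "forcing_sequence G ps \<longleftrightarrow> (\<forall>(x, y) \<in> set ps. x \<rightarrow>\<^bsub>G\<^esub> y) \<and>
     sorted_wrt (\<lambda>(x, y) (_, y'). y' \<noteq> x \<and> y' \<noteq> y \<and> \<not> x \<rightarrow>\<^bsub>G\<^esub> y') ps"

text \<open>Induction from the front of the list: the first pair performs one colour change, after
  which the white vertices are exactly the targets of the remaining pairs.\<close>

lemma forcing_sequence_color_change:
  assumes "loopfree_digraph G" "forcing_sequence G ps"
  shows "(color_change G)\<^sup>*\<^sup>* (verts G - snd ` set ps) (verts G)"
  using assms(2)
proof (induction ps)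
  case Nil
  then show ?case by simp
next
  case (Cons p ps)
  interpret loopfree_digraph G by fact
  obtain x y where p: "p = (x, y)" by (cases p)
  let ?Y = "snd ` set ps"
  have xy: "x \<rightarrow>\<^bsub>G\<^esub> y" and later: "x \<notin> ?Y" "y \<notin> ?Y" "\<forall>z \<in> ?Y. \<not> x \<rightarrow>\<^bsub>G\<^esub> z"
    and ps: "forcing_sequence G ps"
    using Cons.prems by (auto simp: forcing_sequence_def p)
  have vs: "x \<in> verts G" "y \<in> verts G" "x \<noteq> y"
    using xy adj_not_same by auto
  \<comment> \<open>Here \<open>x\<close> is blue, being neither a later target nor, by
    loop-freeness, \<open>y\<close> itself; every white vertex other than \<open>y\<close> is a
    later target, hence not adjacent to \<open>x\<close>.\<close>
  have "color_change G (verts G - insert y ?Y) (insert y (verts G - insert y ?Y))"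
    by (rule color_change.force[of x]) (use xy later vs in auto)
  moreover have "insert y (verts G - insert y ?Y) = verts G - ?Y"
    using vs later by auto
  ultimately show ?case
    using Cons.IH[OF ps] by (simp add: p converse_rtranclp_into_rtranclp)
qed

lemma (in wf_digraph) forcing_sequence_in_verts:
  assumes "forcing_sequence G ps" "(x, y) \<in> set ps"
  shows "x \<in> verts G \<and> y \<in> verts G"
  using assms by (auto simp: forcing_sequence_def dest: adj_in_verts)

lemma forcing_sequence_distinct:
  "forcing_sequence G ps \<Longrightarrow> distinct (map snd ps)"
  by (induction ps) (auto simp: forcing_sequence_def)

lemma forcing_sequence_length_le_mz:
  assumes "loopfree_digraph G" "finite (verts G)" "forcing_sequence G ps"
  shows "length ps \<le> mz G"
proof -
  interpret loopfree_digraph G by fact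
  let ?B = "verts G - snd ` set ps"
  have "zero_forcing_set G ?B"
    using forcing_sequence_color_change[OF assms(1,3)] by (auto simp: zero_forcing_set_def)
  then have "zero_forcing_number G \<le> card ?B"
    unfolding zero_forcing_number_def by (intro Least_le) blast
  moreover have sub: "snd ` set ps \<subseteq> verts G"
    using forcing_sequence_in_verts[OF assms(3)] by auto
  moreover have "card (snd ` set ps) = length ps"
    using distinct_card[OF forcing_sequence_distinct[OF assms(3)]] by simp
  \<comment> \<open>Needed because the subtractions are on naturals: it keeps
    \<open>card (verts G) - length ps\<close> from truncating.\<close>
  moreover have "card (snd ` set ps) \<le> card (verts G)"
    using card_mono[OF assms(2) sub] .
  ultimately show ?thesis
    by (simp add: mz_def card_Diff_subset)
qed

text \<open>All conditions on a forcing sequence concern vertices occurring in it, and on these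
  adjacency in \<open>S\<close> and in \<open>G\<close> agree.\<close>

lemma forcing_sequence_induced_subgraph:
  assumes "induced_subgraph S G" "forcing_sequence S ps"
  shows "forcing_sequence G ps"
proof -
  have sub: "subgraph S G" using assms(1) by (simp add: induced_subgraph_def)
  then interpret S: wf_digraph S by (simp add: subgraph_def)
  have ends: "tail S = tail G" "head S = head G"
    using sub by (simp_all add: subgraph_def compatible_def)
  have arcs: "arcs S = {e \<in> arcs G. tail G e \<in> verts S \<and> head G e \<in> verts S}"
    using assms(1) by (simp add: induced_subgraph_def)
  have adj: "u \<rightarrow>\<^bsub>S\<^esub> v \<longleftrightarrow> u \<rightarrow>\<^bsub>G\<^esub> v" if "u \<in> verts S" "v \<in> verts S" for u v
    using that by (auto simp: arcs_ends_def arc_to_ends_def ends arcs)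
  note vs = S.forcing_sequence_in_verts[OF assms(2)]
  show ?thesis
    unfolding forcing_sequence_def
  proof
    show "\<forall>(x, y) \<in> set ps. x \<rightarrow>\<^bsub>G\<^esub> y"
      using assms(2) adj vs unfolding forcing_sequence_def by blast
    show "sorted_wrt (\<lambda>(x, y) (_, y'). y' \<noteq> x \<and> y' \<noteq> y \<and> \<not> x \<rightarrow>\<^bsub>G\<^esub> y') ps"
      by (rule sorted_wrt_mono_rel[OF _ assms(2)[unfolded forcing_sequence_def, THEN conjunct2]])
        (auto simp: adj dest!: vs)
  qed
qed

text \<open>Injectivity on the vertices preserves the inequalities between members of the sequence
  and makes the isomorphism reflect adjacency, as the non-adjacency conditions require.\<close>

lemma forcing_sequence_app_iso:
  assumes "pre_digraph.digraph_isomorphism H f" "forcing_sequence H ps"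
  shows "forcing_sequence (app_iso f H) (map (map_prod (iso_verts f) (iso_verts f)) ps)"
proof -
  let ?f = "iso_verts f"
  interpret H: wf_digraph H
    using assms(1) by (simp add: pre_digraph.digraph_isomorphism_def)
  have inj: "inj_on ?f (verts H)"
    using assms(1) by (simp add: pre_digraph.digraph_isomorphism_def)
  have ends: "arcs_ends (app_iso f H) = (\<lambda>(u, v). (?f u, ?f v)) ` arcs_ends H"
    by (rule H.arcs_ends_app_iso_eq[OF assms(1)])
  have adj: "?f u \<rightarrow>\<^bsub>app_iso f H\<^esub> ?f v \<longleftrightarrow> u \<rightarrow>\<^bsub>H\<^esub> v" if "u \<in> verts H" "v \<in> verts H" for u v
    using that inj by (auto simp: ends dest: inj_onD H.adj_in_verts)
  note vs = H.forcing_sequence_in_verts[OF assms(2)]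
  show ?thesis
    unfolding forcing_sequence_def sorted_wrt_map
  proof
    show "\<forall>(x, y) \<in> set (map (map_prod ?f ?f) ps). x \<rightarrow>\<^bsub>app_iso f H\<^esub> y"
      using assms(2) by (fastforce simp: forcing_sequence_def ends)
    show "sorted_wrt (\<lambda>p q. (\<lambda>(x, y) (_, y').
      y' \<noteq> x \<and> y' \<noteq> y \<and> \<not> x \<rightarrow>\<^bsub>app_iso f H\<^esub> y') (map_prod ?f ?f p) (map_prod ?f ?f q)) ps"
      by (rule sorted_wrt_mono_rel[OF _ assms(2)[unfolded forcing_sequence_def, THEN conjunct2]])
        (auto simp: adj inj_on_eq_iff[OF inj] dest!: vs)
  qed
qed

lemma mz_ge_if_contains_induced:
  assumes "graph G" "graph H" "contains_induced G H" "forcing_sequence H ps"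
  shows "length ps \<le> mz G"
proof -
  interpret G: graph G by fact
  obtain S where S: "induced_subgraph S G" "digraph_iso S H"
    using assms(3) by (auto simp: contains_induced_def)
  then have "wf_digraph S" by (simp add: induced_subgraph_def subgraph_def)
  \<comment> \<open>The direction is reversed so that \<open>S\<close> becomes an image of
    \<open>H\<close>, along which the sequence can be pushed forward.\<close>
  then have "digraph_iso H S" using S(2) by (rule digraph_iso_swap)
  then obtain f where f: "pre_digraph.digraph_isomorphism H f" "S = app_iso f H"
    by (auto simp: digraph_iso_def)
  have "forcing_sequence G (map (map_prod (iso_verts f) (iso_verts f)) ps)"
    using forcing_sequence_induced_subgraph[OF S(1)] forcing_sequence_app_iso[OF f(1) assms(4)] f(2)
    by simp
  from forcing_sequence_length_le_mz[OF _ _ this] show ?thesis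
    using G.loopfree_digraph_axioms by simp
qed

text \<open>The explicit certificates, in the order of the graphs. For instance, the path
  \<open>2-0-4-1-3\<close> is forced from its end \<open>2\<close>, and in the last graph each of
  the four disjoint edges forces along itself.\<close>

lemma forbidden_graphs_forcing_sequences:
  "list_all2 (\<lambda>H ps. length ps = 4 \<and> forcing_sequence H ps) forbidden_graphs [
    [(2, 0), (0, 4), (4, 1), (1, 3)],
    [(0, 4), (2, 5), (4, 1), (5, 3)],
    [(2, 5), (0, 4), (4, 1), (5, 3)],
    [(1, 4), (2, 5), (4, 0), (5, 3)],
    [(2, 5), (0, 4), (4, 1), (5, 3)],
    [(2, 4), (0, 5), (4, 1), (5, 3)],
    [(2, 5), (0, 3), (5, 1), (1, 4)],
    [(1, 4), (4, 0), (0, 3), (5, 2)],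
    [(1, 4), (2, 5), (4, 0), (0, 3)],
    [(1, 4), (4, 0), (0, 3), (5, 2)],
    [(1, 4), (4, 0), (0, 3), (5, 2)],
    [(1, 4), (4, 0), (0, 3), (5, 2)],
    [(1, 4), (4, 2), (5, 0), (0, 3)],
    [(2, 4), (1, 5), (4, 0), (0, 3)],
    [(2, 0), (0, 5), (4, 1), (1, 3)],
    [(2, 0), (0, 5), (4, 1), (1, 3)],
    [(2, 6), (0, 4), (1, 5), (6, 3)],
    [(1, 5), (0, 4), (5, 2), (6, 3)],
    [(1, 5), (0, 4), (5, 2), (6, 3)],
    [(0, 4), (2, 5), (4, 1), (5, 3)],
    [(1, 4), (2, 5), (5, 0), (0, 3)],
    [(0, 4), (1, 5), (2, 6), (6, 3)],
    [(1, 5), (2, 6), (0, 4), (6, 3)],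
    [(0, 4), (1, 5), (5, 2), (6, 3)],
    [(0, 4), (1, 5), (2, 6), (3, 7)]]"
  \<comment> \<open>Adjacency becomes membership in a concrete edge list, so each certificate can be
    checked by evaluation.\<close>
  unfolding forbidden_graphs_def list.rel_inject forcing_sequence_def edge_graph_simps
  by (intro conjI; code_simp)

theorem proposition6:
  fixes G :: "('a, 'b) pre_digraph"
  assumes "graph G"
    and "mz G \<le> 3"
  shows "\<forall>H \<in> set forbidden_graphs. \<not> contains_induced G H"
proof
  fix H
  assume H: "H \<in> set forbidden_graphs"
  then obtain ps where "length ps = 4" "forcing_sequence H ps"
    using forbidden_graphs_forcing_sequences by (fastforce simp: list_all2_conv_all_nth in_set_conv_nth)
  moreover have "graph H" using H forbidden_graphs_are_graphs by blast
  ultimately show "\<not> contains_induced G H"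
    using mz_ge_if_contains_induced[OF assms(1)] assms(2) by fastforce
qed

end
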